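(* Let $\mathbb{S}=\{(x,y)\in\mathbb{R}^2: x^2+y^2=1\}$. Then: (i) for every $\lambda$ with $0<\lambda\le 2-\sqrt{3}$, the intersection $\mathbb{S}\cap(K_\lambda\times K_\lambda)$ is trivial; (ii) for every $\lambda$ with $0.330384\le\lambda<1/2$, the intersection $\mathbb{S}\cap(K_\lambda\times K_\lambda)$ is non-trivial; (iii) for every $\lambda$ with $0.407493\le\lambda<1/2$, the intersection $\mathbb{S}\cap(K_\lambda\times K_\lambda)$ has the cardinality of the continuum.
   Context: For $\lambda\in(0,1/2)$, $K_\lambda\subset\mathbb{R}$ is the self-similar set generated by the iterated function system $\{f_0(x)=\lambda x,\ f_1(x)=\lambda x+1-\lambda\}$, i.e. the unique nonempty compact set with $K_\lambda=f_0(K_\lambda)\cup f_1(K_\lambda)$; its convex hull is $[0,1]$. The intersection $\mathbb{S}\cap(K_\lambda\times K_\lambda)$ is called trivial if it equals $\{(0,1),(1,0)\}$, and non-trivial otherwise (the points $(0,1)$ and $(1,0)$ always belong to it). *)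

theory Defs
  imports "HOL-Analysis.Analysis"
begin

definition ifs0 :: "real \<Rightarrow> real \<Rightarrow> real" where
  "ifs0 l x = l * x"

definition ifs1 :: "real \<Rightarrow> real \<Rightarrow> real" where
  "ifs1 l x = l * x + 1 - l"

definition is_attractor :: "real \<Rightarrow> real set \<Rightarrow> bool" where
  "is_attractor l K \<longleftrightarrow> compact K \<and> K \<noteq> {} \<and> K = ifs0 l ` K \<union> ifs1 l ` K"

text \<open>The description is proper for every ratio in the open interval from 0 to 1/2; this is the
  lemma \<open>ex1_attractor\<close> below.\<close>
definition K_set :: "real \<Rightarrow> real set" where
  "K_set l = (THE K. is_attractor l K)"

definition unit_circle :: "(real \<times> real) set" where
  "unit_circle = {(x, y). x\<^sup>2 + y\<^sup>2 = 1}"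

definition circle_section :: "real \<Rightarrow> (real \<times> real) set" where
  "circle_section l = unit_circle \<inter> (K_set l \<times> K_set l)"

definition trivial_section :: "real \<Rightarrow> bool" where
  "trivial_section l \<longleftrightarrow> circle_section l = {(0, 1), (1, 0)}"

lemma attractor_subset:
  assumes l: "0 < l" "l < 1/2" and A: "is_attractor l A" and B: "is_attractor l B"
  shows "A \<subseteq> B"
proof -
  have cA: "compact A" "A \<noteq> {}" and eA: "A = ifs0 l ` A \<union> ifs1 l ` A"
    and cB: "compact B" "B \<noteq> {}" and eB: "B = ifs0 l ` B \<union> ifs1 l ` B"
    using A B unfolding is_attractor_def by auto
  have "continuous_on A (\<lambda>x. infdist x B)" by (intro continuous_intros)
  then obtain a where a: "a \<in> A" and mx: "\<And>x. x \<in> A \<Longrightarrow> infdist x B \<le> infdist a B"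
    using continuous_attains_sup[OF cA] by blast
  from a eA obtain a' where a': "a' \<in> A" and d: "a = ifs0 l a' \<or> a = ifs1 l a'" by blast
  obtain b where b: "b \<in> B" "infdist a' B = dist a' b"
    using infdist_attains_inf[of B a'] cB compact_imp_closed by blast
  from b eB have "ifs0 l b \<in> B" "ifs1 l b \<in> B" by blast+
  moreover have "dist (ifs0 l a') (ifs0 l b) = l * dist a' b"
    "dist (ifs1 l a') (ifs1 l b) = l * dist a' b"
    using l by (simp_all add: ifs0_def ifs1_def dist_real_def abs_mult flip: right_diff_distrib)
  ultimately have "infdist a B \<le> l * dist a' b"
    using d infdist_le by metis
  also have "\<dots> \<le> l * infdist a B"
    using mx[OF a'] b l by simp
  finally have "(1 - l) * infdist a B \<le> 0" by (simp add: algebra_simps)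
  then have "infdist a B \<le> 0" using l by (simp add: mult_le_0_iff)
  then have "infdist x B = 0" if "x \<in> A" for x
    using mx[OF that] infdist_nonneg[of x B] by linarith
  then show ?thesis
    using in_closed_iff_infdist_zero[of B] cB compact_imp_closed by blast
qed

lemma ex_attractor:
  assumes l: "0 < l" "l < 1/2"
  shows "\<exists>K. is_attractor l K"
proof -
  define F where "F = (\<lambda>S. ifs0 l ` S \<union> ifs1 l ` S)"
  define G where "G = (\<lambda>n. (F ^^ n) {0..1::real})"
  define K where "K = (\<Inter>n. G n)"
  have G0: "G 0 = {0..1}" and GS: "\<And>n. G (Suc n) = F (G n)" by (simp_all add: G_def)
  have cont: "continuous_on S (ifs0 l)" "continuous_on S (ifs1 l)" for S
    unfolding ifs0_def ifs1_def by (intro continuous_intros)+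
  have r: "ifs0 l x \<in> {0..l}" "ifs1 l x \<in> {1-l..1}" if "x \<in> {0..1}" for x
  proof -
    have "0 \<le> l * x" "l * x \<le> l" using that l by (simp_all add: mult_left_le)
    then show "ifs0 l x \<in> {0..l}" "ifs1 l x \<in> {1-l..1}" by (auto simp: ifs0_def ifs1_def)
  qed
  have G1: "G n \<subseteq> {0..1}" for n
  proof (induction n)
    case (Suc n)
    have "F (G n) \<subseteq> {0..l} \<union> {1-l..1}" unfolding F_def using r Suc by blast
    then show ?case unfolding GS using l by fastforce
  qed (simp add: G0)
  have cG: "compact (G n)" for n
    by (induction n) (auto simp: G0 GS F_def intro!: compact_Un compact_continuous_image cont)
  have GK: "K \<subseteq> G n" for n by (auto simp: K_def)
  have cK: "compact K"
    unfolding K_def using cG by (intro compact_Inter) auto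
  have "0 \<in> G n" for n
    by (induction n) (auto simp: G0 GS F_def ifs0_def intro: image_eqI[where x = 0])
  then have ne: "K \<noteq> {}" by (auto simp: K_def)
  have dec: "G (Suc n) \<subseteq> G n" for n
  proof (induction n)
    case 0 then show ?case using G1[of "Suc 0"] by (simp add: G0)
  next
    case (Suc n)
    then show ?case using GS[of "Suc n"] GS[of n] by (auto simp: F_def)
  qed
  have sub1: "F K \<subseteq> K"
  proof -
    have "F K \<subseteq> G n" for n
    proof -
      have "F K \<subseteq> F (G n)" using GK[of n] by (auto simp: F_def)
      then show ?thesis using GS dec by blast
    qed
    then show ?thesis by (auto simp: K_def)
  qed
  have sub2: "K \<subseteq> F K"
  proof
    fix x assume x: "x \<in> K"
    have xS: "x \<in> ifs0 l ` G n \<or> x \<in> ifs1 l ` G n" for n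
      using x GK[of "Suc n"] GS[of n] by (auto simp: F_def)
    have b0: "x \<le> l" if "x \<in> ifs0 l ` G n" for n using that r(1) G1[of n] by fastforce
    have b1: "1 - l \<le> x" if "x \<in> ifs1 l ` G n" for n using that r(2) G1[of n] by fastforce
    show "x \<in> F K"
    proof (cases "x \<le> l")
      case True
      then have m: "x \<in> ifs0 l ` G n" for n using xS[of n] b1[of n] l by fastforce
      have "x / l \<in> G n" for n using m[of n] l by (auto simp: ifs0_def)
      then have "x / l \<in> K" by (simp add: K_def)
      moreover have "x = ifs0 l (x / l)" using l by (simp add: ifs0_def)
      ultimately show ?thesis by (auto simp: F_def)
    next
      case False
      then have m: "x \<in> ifs1 l ` G n" for n using xS[of n] b0[of n] by blast
      have "(x - 1 + l) / l \<in> G n" for n using m[of n] l by (auto simp: ifs1_def)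
      then have "(x - 1 + l) / l \<in> K" by (simp add: K_def)
      moreover have "x = ifs1 l ((x - 1 + l) / l)" using l by (simp add: ifs1_def)
      ultimately show ?thesis by (auto simp: F_def)
    qed
  qed
  have "K = F K" using sub1 sub2 by blast
  then have "is_attractor l K" using cK ne by (simp add: is_attractor_def F_def)
  then show ?thesis ..
qed

lemma ex1_attractor:
  assumes "0 < l" "l < 1/2"
  shows "\<exists>!K. is_attractor l K"
  using ex_attractor[OF assms] attractor_subset[OF assms] by (metis subset_antisym)

lemma is_attractor_K_set:
  assumes "0 < l" "l < 1/2"
  shows "is_attractor l (K_set l)"
  unfolding K_set_def using ex1_attractor[OF assms] by (rule theI')

end

theory Submission
  imports Defs
begin

text \<open>For small \<open>l\<close>, a point \<open>(x, y)\<close> of the circle near \<open>(0, 1)\<close> has \<open>1 - y\<close> close to \<open>x\<^sup>2 / 2\<close>,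
  and squaring and halving carries the scales of \<open>K\<close> into the gaps of \<open>K\<close>.

  For larger \<open>l\<close>, consider a rectangle whose sides are spanned by two affine copies of \<open>K\<close> in \<open>K\<close>.
  If the two partial derivatives of \<open>x\<^sup>2 + y\<^sup>2\<close>, weighted by the side lengths, are of comparable
  size, then the ranges of \<open>x\<^sup>2 + y\<^sup>2\<close> over the four corner subrectangles cover the range over the
  whole rectangle. This condition is inherited by the subrectangles, so a rectangle crossed by the
  circle contains a point of \<open>K \<times> K\<close> on the circle. Under a stronger condition, consecutive
  ranges overlap so much that repeated subdivision always leads to two disjoint subrectangles that
  are crossed, and the resulting binary tree gives continuum many points.\<close>

section \<open>Cantor schemes of compact sets and increments of squares\<close>

text \<open>A set of natural numbers prescribes which half to keep at each step, and compactness
  gives the nested halves a common point. Different sets part at the first index where they differ,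
  so their points lie in disjoint halves.\<close>

lemma compact_splitting_scheme_lepoll:
  fixes N :: "'a :: heine_borel set set"
  assumes N: "\<And>A. A \<in> N \<Longrightarrow> compact A \<and> A \<noteq> {}"
    and split: "\<And>A. A \<in> N \<Longrightarrow> \<exists>B\<in>N. \<exists>C\<in>N. B \<subseteq> A \<and> C \<subseteq> A \<and> B \<inter> C = {}"
    and N0: "N0 \<in> N"
  shows "(UNIV :: real set) \<lesssim> N0"
proof -
  obtain L R where LR: "\<And>A. A \<in> N \<Longrightarrow>
      L A \<in> N \<and> R A \<in> N \<and> L A \<subseteq> A \<and> R A \<subseteq> A \<and> L A \<inter> R A = {}"
    using split by metis
  define T where "T X = rec_nat N0 (\<lambda>n A. if n \<in> X then L A else R A)" for X
  have T0: "T X 0 = N0" and TS: "T X (Suc n) = (if n \<in> X then L (T X n) else R (T X n))" for X n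
    by (simp_all add: T_def)
  have TN: "T X n \<in> N" for X n
    by (induction n) (auto simp: T0 TS N0 LR)
  have dec: "T X n \<subseteq> T X m" if "m \<le> n" for X m n
  proof (rule lift_Suc_antimono_le[OF _ that])
    show "T X (Suc k) \<subseteq> T X k" for k using LR[OF TN[of X k]] by (auto simp: TS)
  qed
  have "(\<Inter>n. T X n) \<noteq> {}" for X
  proof (rule compact_nest)
    show "compact (T X n)" "T X n \<noteq> {}" for n using N[OF TN[of X n]] by auto
  qed (rule dec)
  then obtain p where p: "\<And>X n. p X \<in> T X n"
    unfolding ex_in_conv[symmetric] INT_iff by (metis UNIV_I)
  have "X = Y" if eq: "p X = p Y" for X Y
  proof (rule ccontr)
    assume "X \<noteq> Y"
    then have "\<exists>n. (n \<in> X) \<noteq> (n \<in> Y)" by auto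
    then obtain n where n: "(n \<in> X) \<noteq> (n \<in> Y)" and le: "\<And>m. m < n \<Longrightarrow> (m \<in> X) = (m \<in> Y)"
      using exists_least_iff[of "\<lambda>n. (n \<in> X) \<noteq> (n \<in> Y)"] by auto
    have "T X m = T Y m" if "m \<le> n" for m
      using that by (induction m) (auto simp: T0 TS le)
    then have "T X (Suc n) \<inter> T Y (Suc n) = {}"
      using n LR[OF TN[of X n]] by (auto simp: TS)
    then show False using p[of X "Suc n"] p[of Y "Suc n"] eq by auto
  qed
  moreover have "p X \<in> N0" for X using p[of X 0] by (simp add: T0)
  ultimately have "(UNIV :: nat set set) \<lesssim> N0"
    unfolding lepoll_def by (intro exI[of _ p]) (auto simp: inj_on_def)
  then show ?thesis
    using nat_sets_eqpoll_reals eqpoll_sym lepoll_trans1 by blast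
qed

text \<open>The difference factors as \<open>(v - u) * (2 * x + u + v)\<close>. With
  \<open>w\<close> the side of an interval starting at \<open>x\<close>, and \<open>c\<close> the
  fraction of it between \<open>u\<close> and \<open>v\<close>, the bounds are weighted slopes at
  the two ends.\<close>

lemma square_increment_bounds:
  fixes x u v w c :: real
  assumes "0 \<le> x" "0 \<le> u" "u \<le> v" "v \<le> w" and c: "v - u = c * w"
  shows "2 * (c * (w * x)) \<le> (x + v)\<^sup>2 - (x + u)\<^sup>2"
    and "(x + v)\<^sup>2 - (x + u)\<^sup>2 \<le> 2 * (c * (w * (x + w)))"
proof -
  have "(x + v)\<^sup>2 - (x + u)\<^sup>2 = (v - u) * (2 * x + u + v)"
    by (simp add: power2_eq_square algebra_simps)
  moreover have "(v - u) * (2 * x) \<le> (v - u) * (2 * x + u + v)"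
    "(v - u) * (2 * x + u + v) \<le> (v - u) * (2 * (x + w))"
    using assms(1-4) by (auto intro!: mult_left_mono)
  ultimately show "2 * (c * (w * x)) \<le> (x + v)\<^sup>2 - (x + u)\<^sup>2"
    and "(x + v)\<^sup>2 - (x + u)\<^sup>2 \<le> 2 * (c * (w * (x + w)))"
    unfolding c by (simp_all add: mult.assoc mult.left_commute)
qed

section \<open>Elementary properties of the self-similar set\<close>

locale middle_cantor =
  fixes l :: real
  assumes l_pos: "0 < l" and l_less_half: "l < 1 / 2"
begin

abbreviation K :: "real set" where "K \<equiv> K_set l"

lemma compact_K: "compact K" and K_ne: "K \<noteq> {}" and K_eq: "K = ifs0 l ` K \<union> ifs1 l ` K"
  using is_attractor_K_set[OF l_pos] l_less_half unfolding is_attractor_def by auto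

lemma K_scale: "x \<in> K \<Longrightarrow> l * x \<in> K" and K_scale_shift: "x \<in> K \<Longrightarrow> l * x + 1 - l \<in> K"
  using K_eq by (auto simp: ifs0_def ifs1_def)

lemma K_cases:
  assumes "x \<in> K"
  obtains y where "y \<in> K" "x = l * y" | y where "y \<in> K" "x = l * y + 1 - l"
  using assms K_eq unfolding ifs0_def ifs1_def by blast

text \<open>The minimum is the image of a point of \<open>K\<close> under one of the maps, so it is
  at least 0; its own image under the first map is in \<open>K\<close>, so it is at most 0.\<close>

lemma zero_in_K: "0 \<in> K" and K_nonneg: "x \<in> K \<Longrightarrow> 0 \<le> x"
proof -
  obtain m where m: "m \<in> K" "\<And>y. y \<in> K \<Longrightarrow> m \<le> y"
    using compact_attains_inf[OF compact_K K_ne] by blast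
  have "0 \<le> m" using m(1)
  proof (cases rule: K_cases)
    case (1 y)
    then have "l * m \<le> m" using m(2)[of y] l_pos by simp
    then have "0 \<le> (1 - l) * m" by (simp add: algebra_simps)
    then show ?thesis using l_less_half by (simp add: zero_le_mult_iff)
  next
    case (2 y)
    then have "l * m \<le> m - (1 - l)" using mult_left_mono[OF m(2)[of y], of l] l_pos by simp
    then have "(1 - l) * 1 \<le> (1 - l) * m" by (simp add: algebra_simps)
    then show ?thesis using l_less_half by (simp add: mult_le_cancel_left)
  qed
  moreover have "(1 - l) * m \<le> 0" using m(2)[OF K_scale[OF m(1)]] by (simp add: algebra_simps)
  then have "m \<le> 0" using l_less_half by (simp add: mult_le_0_iff)
  ultimately show "0 \<in> K" "x \<in> K \<Longrightarrow> 0 \<le> x" using m by auto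
qed

lemma one_in_K: "1 \<in> K" and K_le_one: "x \<in> K \<Longrightarrow> x \<le> 1"
proof -
  obtain m where m: "m \<in> K" "\<And>y. y \<in> K \<Longrightarrow> y \<le> m"
    using compact_attains_sup[OF compact_K K_ne] by blast
  have "(1 - l) * 1 \<le> (1 - l) * m" using m(2)[OF K_scale_shift[OF m(1)]] by (simp add: algebra_simps)
  then have "1 \<le> m" using l_less_half by (simp add: mult_le_cancel_left)
  moreover have "m \<le> 1" using m(1)
  proof (cases rule: K_cases)
    case (1 y)
    then have "m \<le> l * m" using m(2)[of y] l_pos by simp
    then have "(1 - l) * m \<le> 0" by (simp add: algebra_simps)
    then show ?thesis using l_less_half by (simp add: mult_le_0_iff)
  next
    case (2 y)
    then have "m - (1 - l) \<le> l * m" using mult_left_mono[OF m(2)[of y], of l] l_pos by simp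
    then have "(1 - l) * m \<le> (1 - l) * 1" by (simp add: algebra_simps)
    then show ?thesis using l_less_half by (simp add: mult_le_cancel_left)
  qed
  ultimately have "m = 1" by simp
  then show "1 \<in> K" "x \<in> K \<Longrightarrow> x \<le> 1" using m by auto
qed

lemma compact_section: "compact (circle_section l)"
proof -
  have "unit_circle = {p. (fst p)\<^sup>2 + (snd p)\<^sup>2 = (1 :: real)}"
    by (auto simp: unit_circle_def)
  also have "closed \<dots>" by (intro closed_Collect_eq continuous_intros)
  finally show ?thesis
    unfolding circle_section_def by (intro closed_Int_compact compact_Times compact_K)
qed

section \<open>Triviality for small ratios\<close>

text \<open>Dividing points of the left piece by \<open>l\<close> ends in the right piece
  \<open>[1 - l, 1]\<close>; an \<open>n\<close> with \<open>l ^ n < x\<close> bounds the number of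
  divisions.\<close>

lemma K_scale_range:
  assumes "x \<in> K" "0 < x"
  shows "\<exists>n. l ^ n * (1 - l) \<le> x \<and> x \<le> l ^ n"
proof -
  have "\<exists>k. l ^ k * (1 - l) \<le> x \<and> x \<le> l ^ k" if "l ^ n < x" "x \<in> K" for n
    using that
  proof (induction n arbitrary: x)
    case 0 then show ?case using K_le_one[of x] by simp
  next
    case (Suc n)
    from Suc.prems(2) show ?case
    proof (cases rule: K_cases)
      case (1 y)
      with Suc.prems l_pos have "l ^ n < y" by simp
      then obtain k where "l ^ k * (1 - l) \<le> y" "y \<le> l ^ k" using Suc.IH 1 by blast
      then have "l ^ Suc k * (1 - l) \<le> x \<and> x \<le> l ^ Suc k" using 1 l_pos by (simp add: mult.assoc)
      then show ?thesis by blast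
    next
      case (2 y)
      then show ?thesis using K_nonneg[of y] K_le_one[of x] Suc.prems l_pos
        by (intro exI[of _ 0]) simp
    qed
  qed
  moreover obtain n where "l ^ n < x"
    using real_arch_pow_inv[OF assms(2), of l] l_less_half by auto
  ultimately show ?thesis using assms by blast
qed

text \<open>The reflection exchanges the two maps, so the reflected set is an attractor as
  well.\<close>

lemma K_symmetric: "x \<in> K \<Longrightarrow> 1 - x \<in> K"
proof -
  have "(\<lambda>x. 1 - x) ` K = ifs0 l ` (\<lambda>x. 1 - x) ` K \<union> ifs1 l ` (\<lambda>x. 1 - x) ` K"
    by (subst K_eq)
      (auto simp: image_Un image_image ifs0_def ifs1_def algebra_simps)
  then have "is_attractor l ((\<lambda>x. 1 - x) ` K)"
    unfolding is_attractor_def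
    using compact_K K_ne by (auto intro!: compact_continuous_image continuous_intros)
  then have "(\<lambda>x. 1 - x) ` K \<subseteq> K"
    using attractor_subset is_attractor_K_set l_pos l_less_half by blast
  then show "x \<in> K \<Longrightarrow> 1 - x \<in> K" by blast
qed

text \<open>If \<open>x\<close> lies in \<open>[l ^ n * (1 - l), l ^ n]\<close>, then \<open>1 - y = x\<^sup>2 / (1 + y)\<close>, which is roughly
  \<open>x\<^sup>2 / 2\<close>, falls into the gap between \<open>l ^ (2 * n + 1)\<close> and \<open>l ^ (2 * n) * (1 - l)\<close>.\<close>
lemma circle_point_on_axis:
  assumes l4: "0 \<le> l\<^sup>2 - 4 * l + 1"
    and x: "x \<in> K" and y: "y \<in> K" and xy: "x\<^sup>2 + y\<^sup>2 = 1" "x \<le> y"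
  shows "x = 0"
proof (rule ccontr)
  assume "x \<noteq> 0"
  with K_nonneg[OF x] have xp: "0 < x" by simp
  have y1: "y \<le> 1" using K_le_one y by blast
  have u: "(1 - y) * (1 + y) = x\<^sup>2" using xy by (simp add: power2_eq_square algebra_simps)
  have ylt: "y < 1" using xp xy(1) y1 by (smt (verit) one_power2 zero_less_power)
  have "1 - l \<le> y" using y
  proof (cases rule: K_cases)
    case (1 z)
    have "y \<le> 1/2" using 1 K_le_one[of z] l_pos l_less_half by (smt (verit) mult_left_le)
    then have "x\<^sup>2 \<le> (1/2)\<^sup>2" "y\<^sup>2 \<le> (1/2)\<^sup>2"
      using xp xy by (intro power_mono; simp)+
    then show ?thesis using xy by (simp add: power2_eq_square)
  qed (use K_nonneg l_pos in auto)
  obtain n where n: "l ^ n * (1 - l) \<le> x" "x \<le> l ^ n" using K_scale_range[OF x xp] by blast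
  obtain m where m: "l ^ m * (1 - l) \<le> 1 - y" "1 - y \<le> l ^ m"
    using K_scale_range[OF K_symmetric[OF y]] ylt by auto
  define P where "P = l ^ (2 * n)"
  have P: "0 < P" "(l ^ n)\<^sup>2 = P" using l_pos by (simp_all add: P_def power_even_eq)
  have "(l ^ n * (1 - l))\<^sup>2 \<le> x\<^sup>2" "x\<^sup>2 \<le> (l ^ n)\<^sup>2"
    using n l_pos l_less_half xp by (auto intro!: power_mono)
  then have xb: "P * (1 - l)\<^sup>2 \<le> x\<^sup>2" "x\<^sup>2 \<le> P" using P by (simp_all add: power_mult_distrib)
  \<comment> \<open>The hypothesis on \<open>l\<close> says
    \<open>2 * l \<le> (1 - l)\<^sup>2\<close>. Hence \<open>1 - y\<close> exceeds
    \<open>P * l\<close>, and its scale index \<open>m\<close> is at most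
    \<open>2 * n\<close>.\<close>
  have "P * (2 * l) \<le> P * (1 - l)\<^sup>2"
    using P l4 by (intro mult_left_mono) (simp_all add: power2_eq_square algebra_simps)
  also have "\<dots> \<le> (1 - y) * (1 + y)" using xb u by simp
  also have "\<dots> < (1 - y) * 2" using ylt by (intro mult_strict_left_mono) auto
  finally have "P * l < 1 - y" by simp
  then have "l ^ Suc (2 * n) < l ^ m" using m unfolding P_def by (simp add: mult.commute)
  then have "m \<le> 2 * n"
    using power_decreasing[of "Suc (2 * n)" m l] l_pos l_less_half by force
  then have "P \<le> l ^ m" unfolding P_def using l_pos l_less_half by (intro power_decreasing) auto
  then have "P * (1 - l) \<le> l ^ m * (1 - l)" using l_less_half by (intro mult_right_mono) auto
  with m have "P * (1 - l) \<le> 1 - y" by simp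
  \<comment> \<open>The product would exceed \<open>P\<close>, since
    \<open>(1 - l) * (2 - l) - 1 = l\<^sup>2 - 3 * l + 1\<close> is at least
    \<open>l\<close>.\<close>
  then have "P * (1 - l) * (2 - l) \<le> (1 - y) * (1 + y)"
    using \<open>1 - l \<le> y\<close> ylt l_less_half P by (intro mult_mono) auto
  then have "P * ((1 - l) * (2 - l)) \<le> P * 1" using u xb by (simp add: mult.assoc)
  then have "(1 - l) * (2 - l) \<le> 1" using P by (simp add: mult_le_cancel_left)
  then show False using l4 l_pos by (simp add: power2_eq_square algebra_simps)
qed

lemma section_trivial:
  assumes "l \<le> 2 - sqrt 3"
  shows "trivial_section l"
proof -
  have "sqrt 3 \<le> 2 - l" using assms by simp
  then have "(sqrt 3)\<^sup>2 \<le> (2 - l)\<^sup>2" by (intro power_mono) auto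
  then have l4: "0 \<le> l\<^sup>2 - 4 * l + 1" by (simp add: power2_eq_square algebra_simps)
  have "(x = 0 \<and> y = 1) \<or> (x = 1 \<and> y = 0)" if "x \<in> K" "y \<in> K" "x\<^sup>2 + y\<^sup>2 = 1" for x y
  proof (cases "x \<le> y")
    case True
    then have "x = 0" using circle_point_on_axis l4 that by blast
    then show ?thesis using that K_nonneg[of y] by (auto simp: power2_eq_1_iff)
  next
    case False
    then have "y = 0" using circle_point_on_axis[OF l4, of y x] that by (simp add: add.commute)
    then show ?thesis using that K_nonneg[of x] by (auto simp: power2_eq_1_iff)
  qed
  then show ?thesis
    unfolding trivial_section_def circle_section_def unit_circle_def
    using zero_in_K one_in_K by auto
qed

section \<open>Rectangles crossed by the circle\<close>

definition copy :: "real \<Rightarrow> real \<Rightarrow> bool" where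
  "copy a s \<longleftrightarrow> (\<forall>x\<in>K. a + s * x \<in> K)"

lemma copy_whole: "copy 0 1"
  by (simp add: copy_def)

lemma copy_left: "copy a s \<Longrightarrow> copy a (l * s)"
  unfolding copy_def using K_scale by (metis mult.assoc mult.commute)

lemma copy_right:
  assumes "copy a s" shows "copy (a + (1 - l) * s) (l * s)"
  unfolding copy_def
proof
  fix x assume "x \<in> K"
  then have "a + s * (l * x + 1 - l) \<in> K" using assms K_scale_shift by (auto simp: copy_def)
  then show "a + (1 - l) * s + l * s * x \<in> K" by (simp add: algebra_simps)
qed

lemma copy_base: "copy a s \<Longrightarrow> a \<in> K"
  using zero_in_K by (force simp: copy_def)

text \<open>The two inequalities between products make the ranges over consecutive subrectangles overlap;
  \<open>s * a\<close> and \<open>t * b\<close> are half the weighted partial derivatives at the lower left corner.\<close>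
definition crossing_node :: "real \<Rightarrow> real \<Rightarrow> real \<Rightarrow> real \<Rightarrow> bool" where
  "crossing_node a s b t \<longleftrightarrow> 0 < a \<and> 0 < s \<and> 0 < b \<and> 0 < t \<and> copy a s \<and> copy b t \<and>
     (1 - 2 * l) * (t * (b + t)) \<le> l * (s * a) \<and> (1 - 2 * l) * (s * (a + s)) \<le> t * b \<and>
     a\<^sup>2 + b\<^sup>2 \<le> 1 \<and> 1 \<le> (a + s)\<^sup>2 + (b + t)\<^sup>2"

text \<open>Passing to a child scales both side lengths by \<open>l\<close>, while the lower end
  \<open>a\<close> can only grow and the upper end \<open>b + t\<close> only shrink. Free
  \<open>c\<close> and \<open>d\<close> serve both inequalities of a node, with the coordinates
  exchanged.\<close>

lemma weighted_slope_child:
  fixes c :: real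
  assumes "c * (t * (b + t)) \<le> d * (s * a)" "0 \<le> c" "0 \<le> d"
    "0 < a" "0 < s" "0 < b" "0 < t" "a \<le> a'" "b' + l * t \<le> b + t"
  shows "c * (l * t * (b' + l * t)) \<le> d * (l * s * a')"
proof -
  have "c * (l * t * (b' + l * t)) \<le> l * (c * (t * (b + t)))"
    using assms l_pos by (simp add: mult.left_commute mult_left_mono mult.assoc)
  also have "\<dots> \<le> l * (d * (s * a))" using assms l_pos by (simp add: mult_left_mono)
  also have "\<dots> \<le> d * (l * s * a')"
    using assms l_pos by (simp add: mult.left_commute mult_left_mono mult.assoc)
  finally show ?thesis .
qed

lemma weighted_slope_child_strict:
  fixes c :: real
  assumes "c * (t * (b + t)) < d * (s * a)" "0 \<le> c" "0 \<le> d"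
    "0 < a" "0 < s" "0 < b" "0 < t" "a \<le> a'" "b' + l * t \<le> b + t"
  shows "c * (l * t * (b' + l * t)) < d * (l * s * a')"
proof -
  have "c * (l * t * (b' + l * t)) \<le> l * (c * (t * (b + t)))"
    using assms l_pos by (simp add: mult.left_commute mult_left_mono mult.assoc)
  also have "\<dots> < l * (d * (s * a))" using assms l_pos by simp
  also have "\<dots> \<le> d * (l * s * a')"
    using assms l_pos by (simp add: mult.left_commute mult_left_mono mult.assoc)
  finally show ?thesis .
qed

lemma crossing_node_childI:
  assumes "crossing_node a s b t" and a': "a' \<in> {a, a + (1 - l) * s}" and b': "b' \<in> {b, b + (1 - l) * t}"
    and "a'\<^sup>2 + b'\<^sup>2 \<le> 1" "1 \<le> (a' + l * s)\<^sup>2 + (b' + l * t)\<^sup>2"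
  shows "crossing_node a' (l * s) b' (l * t) \<and> a \<le> a' \<and> a' + l * s \<le> a + s \<and> b \<le> b' \<and> b' + l * t \<le> b + t"
proof -
  have pos: "0 < a" "0 < s" "0 < b" "0 < t" using assms(1) by (auto simp: crossing_node_def)
  then have "l * s \<le> s" "l * t \<le> t" "0 < (1 - l) * s" "0 < (1 - l) * t"
    using l_pos l_less_half by auto
  then have in': "a \<le> a'" "a' + l * s \<le> a + s" "b \<le> b'" "b' + l * t \<le> b + t"
    using a' b' by (auto simp: algebra_simps)
  have "copy a' (l * s)" "copy b' (l * t)"
    using assms(1) a' b' copy_left copy_right by (auto simp: crossing_node_def)
  moreover have "(1 - 2 * l) * (l * t * (b' + l * t)) \<le> l * (l * s * a')"
    by (rule weighted_slope_child[of _ t b _ s a]) (use assms(1) l_pos l_less_half in' in \<open>auto simp: crossing_node_def\<close>)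
  moreover have "(1 - 2 * l) * (l * s * (a' + l * s)) \<le> 1 * (l * t * b')"
    by (rule weighted_slope_child[of _ s a _ t b]) (use assms(1) l_pos l_less_half in' in \<open>auto simp: crossing_node_def\<close>)
  ultimately show ?thesis using pos in' assms(4,5) l_pos by (auto simp: crossing_node_def)
qed

text \<open>In the order lower left, upper left, lower right, upper right, the minimum of
  \<open>x\<^sup>2 + y\<^sup>2\<close> over each child is at most the maximum over the preceding one
  (\<open>ab\<close>, \<open>bc\<close>, \<open>cd\<close>), so 1 lies in one of the four
  ranges.\<close>

lemma crossing_node_child:
  assumes nd: "crossing_node a s b t"
  shows "\<exists>a' b'. crossing_node a' (l * s) b' (l * t) \<and>
    a \<le> a' \<and> a' + l * s \<le> a + s \<and> b \<le> b' \<and> b' + l * t \<le> b + t"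
proof -
  have pos: "0 < a" "0 < s" "0 < b" "0 < t" using nd by (auto simp: crossing_node_def)
  have sl: "(1 - 2 * l) * (t * (b + t)) \<le> l * (s * a)" "(1 - 2 * l) * (s * (a + s)) \<le> t * b"
    using nd by (auto simp: crossing_node_def)
  have gt: "0 \<le> l * t" "l * t \<le> (1 - l) * t" "(1 - l) * t \<le> t"
    and gs: "0 \<le> l * s" "l * s \<le> (1 - l) * s" "(1 - l) * s \<le> s"
    using pos l_pos l_less_half by (auto simp: mult_right_mono)
  have d: "(1 - l) * s - l * s = (1 - 2 * l) * s" "(1 - l) * t - l * t = (1 - 2 * l) * t"
    "l * s - 0 = l * s" "s - (1 - l) * s = l * s" "t - 0 = 1 * t"
    by (simp_all add: algebra_simps)
  have gapt: "(b + (1 - l) * t)\<^sup>2 - (b + l * t)\<^sup>2 \<le> 2 * ((1 - 2 * l) * (t * (b + t)))"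
    by (rule square_increment_bounds(2)[OF _ gt d(2)]) (use pos in simp)
  have gaps: "(a + (1 - l) * s)\<^sup>2 - (a + l * s)\<^sup>2 \<le> 2 * ((1 - 2 * l) * (s * (a + s)))"
    by (rule square_increment_bounds(2)[OF _ gs d(1)]) (use pos in simp)
  have ab: "a\<^sup>2 + (b + (1 - l) * t)\<^sup>2 \<le> (a + l * s)\<^sup>2 + (b + l * t)\<^sup>2"
    using square_increment_bounds(1)[OF _ _ _ _ d(3), of a] gapt gs pos sl(1) by simp
  have bc: "(a + (1 - l) * s)\<^sup>2 + b\<^sup>2 \<le> (a + l * s)\<^sup>2 + (b + t)\<^sup>2"
    using square_increment_bounds(1)[OF _ _ _ _ d(5), of b] gaps pos sl(2) by simp
  have cd: "(a + (1 - l) * s)\<^sup>2 + (b + (1 - l) * t)\<^sup>2 \<le> (a + s)\<^sup>2 + (b + l * t)\<^sup>2"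
    using square_increment_bounds(1)[OF _ _ _ _ d(4), of a] gapt gs pos sl(1) by simp
  note ch = crossing_node_childI[OF nd]
  have low: "a\<^sup>2 + b\<^sup>2 \<le> 1" and high: "1 \<le> (a + s)\<^sup>2 + (b + t)\<^sup>2" using nd by (auto simp: crossing_node_def)
  have e: "a + (1 - l) * s + l * s = a + s" "b + (1 - l) * t + l * t = b + t"
    by (simp_all add: algebra_simps)
  consider "1 \<le> (a + l * s)\<^sup>2 + (b + l * t)\<^sup>2"
    | "a\<^sup>2 + (b + (1 - l) * t)\<^sup>2 \<le> 1" "1 \<le> (a + l * s)\<^sup>2 + (b + t)\<^sup>2"
    | "(a + (1 - l) * s)\<^sup>2 + b\<^sup>2 \<le> 1" "1 \<le> (a + s)\<^sup>2 + (b + l * t)\<^sup>2"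
    | "(a + (1 - l) * s)\<^sup>2 + (b + (1 - l) * t)\<^sup>2 \<le> 1"
    using ab bc cd by linarith
  then show ?thesis
  proof cases
    case 1 then show ?thesis using ch[of a b] low by blast
  next
    case 2 then show ?thesis using ch[of a "b + (1 - l) * t"] e by (metis insertCI)
  next
    case 3 then show ?thesis using ch[of "a + (1 - l) * s" b] e by (metis insertCI)
  next
    case 4 then show ?thesis using ch[of "a + (1 - l) * s" "b + (1 - l) * t"] e high by (metis insertCI)
  qed
qed

text \<open>After \<open>n\<close> subdivisions the lower left corner, a point of
  \<open>K \<times> K\<close>, misses the circle equation by at most \<open>l ^ n * M\<close>. The
  deviation \<open>g\<close> attains its minimum on the compact set \<open>C\<close>, which is
  therefore 0.\<close>

lemma crossing_node_meets_section:
  assumes nd: "crossing_node a s b t"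
  shows "circle_section l \<inter> {a..a + s} \<times> {b..b + t} \<noteq> {}"
proof -
  have pos: "0 < a" "0 < s" "0 < b" "0 < t" using nd by (auto simp: crossing_node_def)
  have desc: "\<exists>a' b'. crossing_node a' (l ^ n * s) b' (l ^ n * t) \<and>
      a \<le> a' \<and> a' + l ^ n * s \<le> a + s \<and> b \<le> b' \<and> b' + l ^ n * t \<le> b + t" for n
  proof (induction n)
    case 0 show ?case using nd by (intro exI[of _ a] exI[of _ b]) simp
  next
    case (Suc n)
    then obtain a' b' where IH: "crossing_node a' (l ^ n * s) b' (l ^ n * t)"
      "a \<le> a'" "a' + l ^ n * s \<le> a + s" "b \<le> b'" "b' + l ^ n * t \<le> b + t" by blast
    show ?case using crossing_node_child[OF IH(1)] IH(2-) by (smt (verit) mult.assoc power_Suc)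
  qed
  define C where "C = (K \<times> K) \<inter> {a..a + s} \<times> {b..b + t}"
  define g where "g p = \<bar>(fst p)\<^sup>2 + (snd p)\<^sup>2 - 1\<bar>" for p :: "real \<times> real"
  define M where "M = 2 * (s * (a + s)) + 2 * (t * (b + t))"
  have small: "\<exists>p\<in>C. g p \<le> l ^ n * M" for n
  proof -
    obtain a' b' where d: "crossing_node a' (l ^ n * s) b' (l ^ n * t)"
      "a \<le> a'" "a' + l ^ n * s \<le> a + s" "b \<le> b'" "b' + l ^ n * t \<le> b + t" using desc by blast
    have p0: "0 < l ^ n * s" "0 < l ^ n * t" "0 < a'" "0 < b'" using d by (auto simp: crossing_node_def)
    have "(a', b') \<in> C" using d p0 copy_base by (auto simp: C_def crossing_node_def)
    moreover have "(a' + l ^ n * s)\<^sup>2 - a'\<^sup>2 \<le> 2 * (l ^ n * s * (a + s))"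
    proof -
      have "(a' + l ^ n * s)\<^sup>2 - a'\<^sup>2 \<le> 2 * (l ^ n * s * (a' + l ^ n * s))"
        using square_increment_bounds(2)[of a' 0 "l ^ n * s" "l ^ n * s" 1] p0 by simp
      also have "\<dots> \<le> 2 * (l ^ n * s * (a + s))" using d p0 by (intro mult_left_mono) auto
      finally show ?thesis .
    qed
    moreover have "(b' + l ^ n * t)\<^sup>2 - b'\<^sup>2 \<le> 2 * (l ^ n * t * (b + t))"
    proof -
      have "(b' + l ^ n * t)\<^sup>2 - b'\<^sup>2 \<le> 2 * (l ^ n * t * (b' + l ^ n * t))"
        using square_increment_bounds(2)[of b' 0 "l ^ n * t" "l ^ n * t" 1] p0 by simp
      also have "\<dots> \<le> 2 * (l ^ n * t * (b + t))" using d p0 by (intro mult_left_mono) auto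
      finally show ?thesis .
    qed
    ultimately have "g (a', b') \<le> l ^ n * M"
      using d(1) by (simp add: g_def M_def crossing_node_def algebra_simps)
    then show ?thesis using \<open>(a', b') \<in> C\<close> by blast
  qed
  have "compact C" unfolding C_def
    by (intro compact_Int compact_Times compact_K compact_Icc)
  moreover have "C \<noteq> {}" using small[of 0] by blast
  moreover have "continuous_on C g" unfolding g_def by (intro continuous_intros)
  ultimately obtain p where p: "p \<in> C" "\<And>q. q \<in> C \<Longrightarrow> g p \<le> g q"
    using continuous_attains_inf[of C g] by blast
  have "g p \<le> l ^ n * M" for n using small[of n] p(2) by force
  moreover have "(\<lambda>n. l ^ n * M) \<longlonglongrightarrow> 0 * M"
    using l_pos l_less_half by (intro tendsto_mult tendsto_const LIMSEQ_power_zero) simp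
  ultimately have "g p \<le> 0" using LIMSEQ_le_const[of "\<lambda>n. l ^ n * M" 0 "g p"] by auto
  then have "p \<in> unit_circle" by (auto simp: g_def unit_circle_def split: prod.splits)
  then show ?thesis using p(1) by (auto simp: C_def circle_section_def)
qed

lemma section_nontrivial_of_node:
  assumes nd: "crossing_node a s b t"
  shows "\<not> trivial_section l"
proof
  assume "trivial_section l"
  moreover have "0 < a" "0 < b" using nd by (auto simp: crossing_node_def)
  ultimately show False
    using crossing_node_meets_section[OF nd] by (auto simp: trivial_section_def)
qed

section \<open>Rectangles that split in two\<close>

text \<open>The factor \<open>1 - l - l\<^sup>2\<close> is the relative gap between the leftmost
  piece of level two and the right piece of level one. The bound \<open>l * (t * b)\<close> makes
  the range over each right child start before the range over the left child at the same height
  ends. Strictness keeps both corners off the circle, as the limit argument requires.\<close>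

definition branching_node :: "real \<Rightarrow> real \<Rightarrow> real \<Rightarrow> real \<Rightarrow> bool" where
  "branching_node a s b t \<longleftrightarrow> 0 < a \<and> 0 < s \<and> 0 < b \<and> 0 < t \<and> copy a s \<and> copy b t \<and>
     (1 - l - l\<^sup>2) * (t * (b + t)) < l * (s * a) \<and> (1 - 2 * l) * (s * (a + s)) < l * (t * b) \<and>
     a\<^sup>2 + b\<^sup>2 < 1 \<and> 1 < (a + s)\<^sup>2 + (b + t)\<^sup>2"

lemma branching_node_slope:
  assumes "branching_node a s b t"
  shows "(1 - 2 * l) * (t * (b + t)) < l * (s * a)"
proof -
  have "0 < t * (b + t)" using assms by (auto simp: branching_node_def)
  moreover have "l * l \<le> l * 1" using l_pos l_less_half by (intro mult_left_mono) auto
  ultimately have "(1 - 2 * l) * (t * (b + t)) \<le> (1 - l - l\<^sup>2) * (t * (b + t))"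
    by (intro mult_right_mono) (auto simp: power2_eq_square)
  also have "\<dots> < l * (s * a)" using assms by (simp add: branching_node_def)
  finally show ?thesis .
qed

lemma branching_imp_crossing_node:
  assumes "branching_node a s b t"
  shows "crossing_node a s b t"
proof -
  have "0 < t * b" and "(1 - 2 * l) * (s * (a + s)) < l * (t * b)"
    using assms by (auto simp: branching_node_def)
  moreover have "l * (t * b) \<le> 1 * (t * b)"
    using \<open>0 < t * b\<close> l_less_half by (intro mult_right_mono) auto
  ultimately have "(1 - 2 * l) * (s * (a + s)) \<le> t * b" by linarith
  then show ?thesis using assms branching_node_slope[OF assms]
    unfolding branching_node_def crossing_node_def by auto
qed

lemma branching_node_childI:
  assumes "branching_node a s b t" and a': "a' \<in> {a, a + (1 - l) * s}" and b': "b' \<in> {b, b + (1 - l) * t}"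
    and "a'\<^sup>2 + b'\<^sup>2 < 1" "1 < (a' + l * s)\<^sup>2 + (b' + l * t)\<^sup>2"
  shows "branching_node a' (l * s) b' (l * t)"
proof -
  have pos: "0 < a" "0 < s" "0 < b" "0 < t" using assms(1) by (auto simp: branching_node_def)
  then have "l * s \<le> s" "l * t \<le> t" "0 < (1 - l) * s" "0 < (1 - l) * t"
    using l_pos l_less_half by auto
  then have in': "a \<le> a'" "a' + l * s \<le> a + s" "b \<le> b'" "b' + l * t \<le> b + t"
    using a' b' by (auto simp: algebra_simps)
  have "l\<^sup>2 \<le> (1 / 2)\<^sup>2" using l_pos l_less_half by (intro power_mono) auto
  then have l2: "0 \<le> 1 - l - l\<^sup>2" using l_less_half by (simp add: power2_eq_square)
  have "copy a' (l * s)" "copy b' (l * t)"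
    using assms(1) a' b' copy_left copy_right by (auto simp: branching_node_def)
  moreover have "(1 - l - l\<^sup>2) * (l * t * (b' + l * t)) < l * (l * s * a')"
    by (rule weighted_slope_child_strict[of _ t b _ s a]) (use assms(1) l_pos l2 in' in \<open>auto simp: branching_node_def\<close>)
  moreover have "(1 - 2 * l) * (l * s * (a' + l * s)) < l * (l * t * b')"
    by (rule weighted_slope_child_strict[of _ s a _ t b]) (use assms(1) l_pos l_less_half in' in \<open>auto simp: branching_node_def\<close>)
  ultimately show ?thesis using pos in' assms(4,5) l_pos by (auto simp: branching_node_def)
qed

text \<open>The two rectangles may lie at any depth, which allows a descent towards a corner before
  the actual splitting.\<close>

definition splits :: "real \<Rightarrow> real \<Rightarrow> real \<Rightarrow> real \<Rightarrow> bool" where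
  "splits a s b t \<longleftrightarrow> (\<exists>a1 s1 b1 t1 a2 s2 b2 t2. branching_node a1 s1 b1 t1 \<and> branching_node a2 s2 b2 t2 \<and>
     {a1..a1 + s1} \<times> {b1..b1 + t1} \<subseteq> {a..a + s} \<times> {b..b + t} \<and>
     {a2..a2 + s2} \<times> {b2..b2 + t2} \<subseteq> {a..a + s} \<times> {b..b + t} \<and>
     {a1..a1 + s1} \<times> {b1..b1 + t1} \<inter> {a2..a2 + s2} \<times> {b2..b2 + t2} = {})"

lemma splitsI:
  assumes "branching_node a1 s1 b1 t1" "branching_node a2 s2 b2 t2"
    "a \<le> a1" "a1 + s1 \<le> a + s" "b \<le> b1" "b1 + t1 \<le> b + t"
    "a \<le> a2" "a2 + s2 \<le> a + s" "b \<le> b2" "b2 + t2 \<le> b + t"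
    "a1 + s1 < a2 \<or> b1 + t1 < b2"
  shows "splits a s b t"
proof -
  have "{a1..a1 + s1} \<times> {b1..b1 + t1} \<subseteq> {a..a + s} \<times> {b..b + t}"
    "{a2..a2 + s2} \<times> {b2..b2 + t2} \<subseteq> {a..a + s} \<times> {b..b + t}"
    "{a1..a1 + s1} \<times> {b1..b1 + t1} \<inter> {a2..a2 + s2} \<times> {b2..b2 + t2} = {}"
    using assms(3-) by auto
  then show ?thesis unfolding splits_def using assms(1,2) by blast
qed

lemma splits_mono:
  assumes "splits a s b t" "a' \<le> a" "a + s \<le> a' + s'" "b' \<le> b" "b + t \<le> b' + t'"
  shows "splits a' s' b' t'"
proof -
  have "{a..a + s} \<times> {b..b + t} \<subseteq> {a'..a' + s'} \<times> {b'..b' + t'}" using assms(2-) by auto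
  with assms(1) show ?thesis unfolding splits_def by (meson subset_trans)
qed

text \<open>By \<open>low\<close> and \<open>high\<close>, 1 lies above the minimum over the upper
  left child and below the maximum over the lower right child. With the overlaps \<open>bc\<close>
  and \<open>bd\<close>, two consecutive children in the order lower left, upper left, lower right,
  upper right are then crossed.\<close>

lemma splits_middle:
  assumes nd: "branching_node a s b t"
    and low: "a\<^sup>2 + (b + (1 - l) * t)\<^sup>2 < 1" and high: "1 < (a + s)\<^sup>2 + (b + l * t)\<^sup>2"
  shows "splits a s b t"
proof -
  have pos: "0 < a" "0 < s" "0 < b" "0 < t" using nd by (auto simp: branching_node_def)
  have sl: "(1 - 2 * l) * (s * (a + s)) < l * (t * b)"
    and low0: "a\<^sup>2 + b\<^sup>2 < 1" and high1: "1 < (a + s)\<^sup>2 + (b + t)\<^sup>2"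
    using nd by (auto simp: branching_node_def)
  have gt: "0 < l * t" "l * t < (1 - l) * t" "(1 - l) * t < t"
    and gs: "0 < l * s" "l * s < (1 - l) * s" "(1 - l) * s < s"
    using pos l_pos l_less_half by auto
  have d: "(1 - l) * s - l * s = (1 - 2 * l) * s" "l * t - 0 = l * t" "t - (1 - l) * t = l * t"
    by (simp_all add: algebra_simps)
  have gap: "(a + (1 - l) * s)\<^sup>2 - (a + l * s)\<^sup>2 < 2 * (l * (t * b))"
    using square_increment_bounds(2)[OF _ _ _ _ d(1), of a] gs pos sl by simp
  have bc: "(a + (1 - l) * s)\<^sup>2 + b\<^sup>2 < (a + l * s)\<^sup>2 + (b + l * t)\<^sup>2"
    using square_increment_bounds(1)[OF _ _ _ _ d(2), of b] gap gt pos by simp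
  have bd: "(a + (1 - l) * s)\<^sup>2 + (b + (1 - l) * t)\<^sup>2 < (a + l * s)\<^sup>2 + (b + t)\<^sup>2"
    using square_increment_bounds(1)[OF _ _ _ _ d(3), of b] gap gt pos by simp
  have mono: "(a + l * s)\<^sup>2 + (b + l * t)\<^sup>2 < (a + l * s)\<^sup>2 + (b + t)\<^sup>2"
    "(a + (1 - l) * s)\<^sup>2 + b\<^sup>2 < (a + (1 - l) * s)\<^sup>2 + (b + (1 - l) * t)\<^sup>2"
    using gt pos by (auto intro!: power_strict_mono)
  have e: "a + (1 - l) * s + l * s = a + s" "b + (1 - l) * t + l * t = b + t"
    by (simp_all add: algebra_simps)
  note ch = branching_node_childI[OF nd]
  consider "1 < (a + l * s)\<^sup>2 + (b + l * t)\<^sup>2"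
    | "(a + (1 - l) * s)\<^sup>2 + b\<^sup>2 < 1" "1 < (a + l * s)\<^sup>2 + (b + t)\<^sup>2"
    | "(a + (1 - l) * s)\<^sup>2 + (b + (1 - l) * t)\<^sup>2 < 1"
    using bc bd by linarith
  then show ?thesis
  proof cases
    case 1
    then have "branching_node a (l * s) b (l * t)" "branching_node a (l * s) (b + (1 - l) * t) (l * t)"
      using ch[of a b] ch[of a "b + (1 - l) * t"] low low0 mono by (auto simp: e)
    then show ?thesis by (rule splitsI) (use gs gt e in linarith)+
  next
    case 2
    then have "branching_node a (l * s) (b + (1 - l) * t) (l * t)" "branching_node (a + (1 - l) * s) (l * s) b (l * t)"
      using ch[of "a + (1 - l) * s" b] ch[of a "b + (1 - l) * t"] low high mono by (auto simp: e)
    then show ?thesis by (rule splitsI) (use gs gt e in linarith)+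
  next
    case 3
    then have "branching_node (a + (1 - l) * s) (l * s) b (l * t)" "branching_node (a + (1 - l) * s) (l * s) (b + (1 - l) * t) (l * t)"
      using ch[of "a + (1 - l) * s" b] ch[of "a + (1 - l) * s" "b + (1 - l) * t"] high high1 mono by (auto simp: e)
    then show ?thesis by (rule splitsI) (use gs gt e in linarith)+
  qed
qed

text \<open>If the circle passes so close to the lower left corner that only the lower left child meets it,
  replacing the node by this child magnifies the distance to the corner. The condition with
  \<open>1 - l - l\<^sup>2\<close> ensures that this does not overshoot the middle range of \<open>splits_middle\<close>.\<close>
lemma splits_near_lower_corner:
  assumes "branching_node a s b t" "1 < (a + s)\<^sup>2 + (b + l * t)\<^sup>2"
    "a\<^sup>2 + (b + (1 - l) * (l ^ n * t))\<^sup>2 < 1"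
  shows "splits a s b t"
  using assms
proof (induction n arbitrary: s t)
  case 0 then show ?case using splits_middle by simp
next
  case (Suc n)
  note nd = Suc.prems(1)
  show ?case
  proof (cases "a\<^sup>2 + (b + (1 - l) * t)\<^sup>2 < 1")
    case True then show ?thesis using splits_middle Suc.prems by blast
  next
    case False
    have pos: "0 < a" "0 < s" "0 < b" "0 < t" using nd by (auto simp: branching_node_def)
    have sl: "(1 - l - l\<^sup>2) * (t * (b + t)) < l * (s * a)" using nd by (auto simp: branching_node_def)
    have g: "0 < l * (l * t)" "l * (l * t) \<le> l * t" "l * t \<le> (1 - l) * t" "(1 - l) * t \<le> t"
      "0 < l * s" "l * t \<le> t" "l * s \<le> s"
      using pos l_pos l_less_half by auto
    have d: "(1 - l) * t - l * (l * t) = (1 - l - l\<^sup>2) * t" "l * s - 0 = l * s"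
      by (simp_all add: algebra_simps power2_eq_square)
    have "(b + (1 - l) * t)\<^sup>2 - (b + l * (l * t))\<^sup>2 \<le> 2 * ((1 - l - l\<^sup>2) * (t * (b + t)))"
      by (rule square_increment_bounds(2)[OF _ _ _ _ d(1)]) (use g pos in linarith)+
    moreover have "2 * (l * (s * a)) \<le> (a + l * s)\<^sup>2 - a\<^sup>2"
      using square_increment_bounds(1)[OF _ _ _ _ d(2), of a] g pos by simp
    \<comment> \<open>This is the maximum over the lower right child of the lower left child, as the
      induction hypothesis demands.\<close>
    ultimately have high: "1 < (a + l * s)\<^sup>2 + (b + l * (l * t))\<^sup>2" using False sl by linarith
    moreover have "(b + l * (l * t))\<^sup>2 \<le> (b + l * t)\<^sup>2" using g pos by (intro power_mono) auto
    ultimately have "branching_node a (l * s) b (l * t)"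
      using nd by (intro branching_node_childI[OF nd]) (auto simp: branching_node_def)
    then have "splits a (l * s) b (l * t)"
      using Suc.prems(3) high by (intro Suc.IH) (simp_all add: mult.left_commute mult.assoc)
    then show ?thesis by (rule splits_mono) (use g in linarith)+
  qed
qed

text \<open>The mirror image: upper right children share the corner \<open>(a + s, b + t)\<close>.
  The last premise is the condition \<open>high\<close> of \<open>splits_middle\<close> for the
  \<open>n\<close>-th such descendant.\<close>

lemma splits_near_upper_corner:
  assumes "branching_node a s b t" "a\<^sup>2 + (b + (1 - l) * t)\<^sup>2 < 1"
    "1 < (a + s)\<^sup>2 + (b + t - (1 - l) * (l ^ n * t))\<^sup>2"
  shows "splits a s b t"
  using assms
proof (induction n arbitrary: a s b t)
  case 0 then show ?case using splits_middle[of a s b t] by (simp add: algebra_simps)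
next
  case (Suc n)
  note nd = Suc.prems(1)
  show ?case
  proof (cases "1 < (a + s)\<^sup>2 + (b + l * t)\<^sup>2")
    case True then show ?thesis using splits_middle Suc.prems by blast
  next
    case False
    let ?a = "a + (1 - l) * s" and ?b = "b + (1 - l) * t"
    have pos: "0 < a" "0 < s" "0 < b" "0 < t" using nd by (auto simp: branching_node_def)
    have sl: "(1 - l - l\<^sup>2) * (t * (b + t)) < l * (s * a)" using nd by (auto simp: branching_node_def)
    have g: "0 < l * (l * t)" "l * (l * t) \<le> l * t" "0 < l * t" "l * t \<le> (1 - l) * t" "(1 - l) * t \<le> t"
      "0 < l * s" "l * t \<le> t" "l * s \<le> s" "0 < (1 - l) * s" "0 < (1 - l) * (l * t)" "(1 - l) * s \<le> s"
      using pos l_pos l_less_half by auto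
    have e: "?a + l * s = a + s" "?b + l * t = b + t" by (simp_all add: algebra_simps)
    have d: "t - l * (l * t) - l * t = (1 - l - l\<^sup>2) * t" "s - (1 - l) * s = l * s"
      by (simp_all add: algebra_simps power2_eq_square)
    \<comment> \<open>The upper left child of the upper right child starts at this height.\<close>
    have top: "b + (t - l * (l * t)) = ?b + (1 - l) * (l * t)" by (simp add: algebra_simps)
    have "(b + (t - l * (l * t)))\<^sup>2 - (b + l * t)\<^sup>2 \<le> 2 * ((1 - l - l\<^sup>2) * (t * (b + t)))"
    proof (rule square_increment_bounds(2)[OF _ _ _ _ d(1)])
      have "(1 - l) * t = t - l * t" by (simp add: algebra_simps)
      then show "l * t \<le> t - l * (l * t)" using g by linarith
    qed (use g pos in linarith)+
    moreover have "2 * (l * (s * a)) \<le> (a + s)\<^sup>2 - ?a\<^sup>2"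
      using square_increment_bounds(1)[OF _ _ _ _ d(2), of a] g pos by simp
    ultimately have low: "?a\<^sup>2 + (?b + (1 - l) * (l * t))\<^sup>2 < 1" using False sl unfolding top by linarith
    moreover have "?b\<^sup>2 \<le> (?b + (1 - l) * (l * t))\<^sup>2" using g pos by (intro power_mono) auto
    ultimately have "branching_node ?a (l * s) ?b (l * t)"
      using nd by (intro branching_node_childI[OF nd]) (auto simp: branching_node_def e)
    then have "splits ?a (l * s) ?b (l * t)"
      using Suc.prems(3) low by (intro Suc.IH) (simp_all add: e mult.left_commute mult.assoc)
    then show ?thesis by (rule splits_mono) (use g e in linarith)+
  qed
qed

text \<open>The first case descends to the upper right corner, the second to the lower left one. A
  suitable depth exists because 1 differs from the value at that corner.\<close>

lemma branching_node_splits: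
  assumes nd: "branching_node a s b t"
  shows "splits a s b t"
proof -
  have pos: "0 < a" "0 < s" "0 < b" "0 < t" and low: "a\<^sup>2 + b\<^sup>2 < 1" and high: "1 < (a + s)\<^sup>2 + (b + t)\<^sup>2"
    using nd by (auto simp: branching_node_def)
  have lim: "(\<lambda>n. (1 - l) * (l ^ n * t)) \<longlonglongrightarrow> (1 - l) * (0 * t)"
    using l_pos l_less_half by (intro tendsto_mult tendsto_const LIMSEQ_power_zero) simp
  show ?thesis
  proof (cases "a\<^sup>2 + (b + (1 - l) * t)\<^sup>2 < 1")
    case True
    have "(\<lambda>n. (a + s)\<^sup>2 + (b + t - (1 - l) * (l ^ n * t))\<^sup>2) \<longlonglongrightarrow> (a + s)\<^sup>2 + (b + t - (1 - l) * (0 * t))\<^sup>2"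
      by (intro tendsto_intros lim)
    then have "\<forall>\<^sub>F n in sequentially. 1 < (a + s)\<^sup>2 + (b + t - (1 - l) * (l ^ n * t))\<^sup>2"
      by (rule order_tendstoD) (use high in simp)
    then show ?thesis
      using splits_near_upper_corner[OF nd True] by (auto simp: eventually_sequentially)
  next
    case False
    have "2 * ((1 - 2 * l) * (t * (b + t))) < 2 * (l * (s * a))"
      using branching_node_slope[OF nd] by simp
    moreover have g: "0 < l * t" "l * t \<le> (1 - l) * t" "(1 - l) * t \<le> t" "0 < l * s" "l * s \<le> s"
      using pos l_pos l_less_half by auto
    moreover have d: "(1 - l) * t - l * t = (1 - 2 * l) * t" "l * s - 0 = l * s"
      by (simp_all add: algebra_simps)
    moreover have "(b + (1 - l) * t)\<^sup>2 - (b + l * t)\<^sup>2 \<le> 2 * ((1 - 2 * l) * (t * (b + t)))"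
      by (rule square_increment_bounds(2)[OF _ _ _ _ d(1)]) (use g pos in linarith)+
    moreover have "2 * (l * (s * a)) \<le> (a + l * s)\<^sup>2 - a\<^sup>2"
      using square_increment_bounds(1)[OF _ _ _ _ d(2), of a] g pos by simp
    moreover have "(a + l * s)\<^sup>2 \<le> (a + s)\<^sup>2" using g pos by (intro power_mono) auto
    \<comment> \<open>Here 1 is at most the minimum over the upper left child, which is below the
      maximum over the lower left child and hence over the lower right one.\<close>
    ultimately have up: "1 < (a + s)\<^sup>2 + (b + l * t)\<^sup>2" using False by linarith
    have "(\<lambda>n. a\<^sup>2 + (b + (1 - l) * (l ^ n * t))\<^sup>2) \<longlonglongrightarrow> a\<^sup>2 + (b + (1 - l) * (0 * t))\<^sup>2"
      by (intro tendsto_intros lim)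
    then have "\<forall>\<^sub>F n in sequentially. a\<^sup>2 + (b + (1 - l) * (l ^ n * t))\<^sup>2 < 1"
      by (rule order_tendstoD) (use low in simp)
    then show ?thesis
      using splits_near_lower_corner[OF nd up] by (auto simp: eventually_sequentially)
  qed
qed

section \<open>Cardinality of the section\<close>

text \<open>As \<open>K\<close> has no negative elements, the first coordinate determines the
  second.\<close>

lemma section_lepoll_real: "circle_section l \<lesssim> (UNIV :: real set)"
proof -
  have "inj_on fst (circle_section l)"
  proof (rule inj_onI)
    fix p q assume p: "p \<in> circle_section l" and q: "q \<in> circle_section l" and eq: "fst p = fst q"
    have "(fst p)\<^sup>2 + (snd p)\<^sup>2 = 1" "(fst q)\<^sup>2 + (snd q)\<^sup>2 = 1" "snd p \<in> K" "snd q \<in> K"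
      using p q by (auto simp: circle_section_def unit_circle_def)
    moreover from this have "(snd p)\<^sup>2 = (snd q)\<^sup>2" unfolding eq by linarith
    ultimately have "(snd p)\<^sup>2 = (snd q)\<^sup>2" "0 \<le> snd p" "0 \<le> snd q" using K_nonneg by blast+
    then have "snd p = snd q" by (rule power2_eq_imp_eq)
    then show "p = q" using eq by (simp add: prod_eq_iff)
  qed
  then show ?thesis unfolding lepoll_def by blast
qed

lemma section_eqpoll_real_of_node:
  assumes "branching_node a s b t"
  shows "circle_section l \<approx> (UNIV :: real set)"
proof -
  define piece where "piece a s b t = circle_section l \<inter> {a..a + s} \<times> {b..b + t}" for a s b t
  define N where "N = {piece a s b t | a s b t. branching_node a s b t}"
  have "(UNIV :: real set) \<lesssim> piece a s b t"
  proof (rule compact_splitting_scheme_lepoll)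
    show "piece a s b t \<in> N" using assms by (auto simp: N_def)
  next
    fix A assume "A \<in> N"
    then obtain a s b t where A: "A = piece a s b t" and nd: "branching_node a s b t" by (auto simp: N_def)
    show "compact A \<and> A \<noteq> {}"
      using crossing_node_meets_section[OF branching_imp_crossing_node[OF nd]]
      unfolding A piece_def by (intro conjI compact_Int compact_section compact_Times compact_Icc)
    obtain a1 s1 b1 t1 a2 s2 b2 t2 where "branching_node a1 s1 b1 t1" "branching_node a2 s2 b2 t2"
      "{a1..a1 + s1} \<times> {b1..b1 + t1} \<subseteq> {a..a + s} \<times> {b..b + t}"
      "{a2..a2 + s2} \<times> {b2..b2 + t2} \<subseteq> {a..a + s} \<times> {b..b + t}"
      "{a1..a1 + s1} \<times> {b1..b1 + t1} \<inter> {a2..a2 + s2} \<times> {b2..b2 + t2} = {}"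
      using branching_node_splits[OF nd] unfolding splits_def by blast
    then have "piece a1 s1 b1 t1 \<in> N" "piece a2 s2 b2 t2 \<in> N"
      "piece a1 s1 b1 t1 \<subseteq> A" "piece a2 s2 b2 t2 \<subseteq> A" "piece a1 s1 b1 t1 \<inter> piece a2 s2 b2 t2 = {}"
      unfolding A piece_def N_def by blast+
    then show "\<exists>B\<in>N. \<exists>C\<in>N. B \<subseteq> A \<and> C \<subseteq> A \<and> B \<inter> C = {}" by blast
  qed
  also have "\<dots> \<lesssim> circle_section l" by (rule subset_imp_lepoll) (auto simp: piece_def)
  finally show ?thesis by (rule lepoll_antisym[OF section_lepoll_real])
qed

section \<open>Explicit starting rectangles\<close>

lemma copy_words:
  "copy (1 - l) (l ^ 3)" "copy ((1 - l) * (1 + l\<^sup>2)) (l ^ 3)"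
  "copy (1 - l ^ 3) (l ^ 4)" "copy (l * (1 - l)) (l ^ 3)"
proof -
  show "copy (1 - l) (l ^ 3)"
    using copy_left[OF copy_left[OF copy_right[OF copy_whole]]] by (simp add: power3_eq_cube mult.assoc)
  show "copy ((1 - l) * (1 + l\<^sup>2)) (l ^ 3)"
    using copy_right[OF copy_left[OF copy_right[OF copy_whole]]]
    by (simp add: power3_eq_cube power2_eq_square algebra_simps)
  show "copy (1 - l ^ 3) (l ^ 4)"
    using copy_left[OF copy_right[OF copy_right[OF copy_right[OF copy_whole]]]]
    by (simp add: power3_eq_cube power4_eq_xxxx power2_eq_square algebra_simps)
  show "copy (l * (1 - l)) (l ^ 3)"
    using copy_left[OF copy_right[OF copy_left[OF copy_whole]]]
    by (simp add: power3_eq_cube mult.assoc algebra_simps)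
qed

text \<open>The two intervals are the images of \<open>[0, 1]\<close> under \<open>f\<^sub>1 f\<^sub>0 f\<^sub>1\<close> and \<open>f\<^sub>1 f\<^sub>0 f\<^sub>0\<close>. The
  constant 0.330384 is just above the root of \<open>?a\<^sup>2 + ?b\<^sup>2 = 1\<close>.\<close>
lemma section_nontrivial:
  assumes "330384 / 1000000 \<le> l" "l \<le> 163 / 400"
  shows "\<not> trivial_section l"
proof (rule section_nontrivial_of_node)
  let ?a = "(1 - l) * (1 + l\<^sup>2)" and ?b = "1 - l" and ?s = "l ^ 3"
  have s: "0 < ?s" using l_pos by simp
  have a: "0 < ?a" using l_less_half by (intro mult_pos_pos add_pos_nonneg) auto
  have as: "?a + ?s = 1 - l + l\<^sup>2" by (simp add: power2_eq_square power3_eq_cube algebra_simps)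
  \<comment> \<open>With the common side \<open>?s\<close> cancelled, the first slope condition is
    this inequality. For \<open>l\<close> below 1/3 the term \<open>l ^ 4\<close> outweighs the
    negative product.\<close>
  have "(3 * l - 1) * (1 - l) + l ^ 4 \<ge> 0"
  proof (cases "1 \<le> 3 * l")
    case True
    then show ?thesis using l_less_half by simp
  next
    case False
    have "(330384 / 1000000) ^ 4 \<le> l ^ 4" using assms by (intro power_mono) auto
    moreover have "(1 - 3 * l) * (1 - l) \<le> 1 / 100 * 1"
      using False assms l_pos l_less_half by (intro mult_mono) auto
    moreover have "(3 * l - 1) * (1 - l) = - ((1 - 3 * l) * (1 - l))" by (simp add: algebra_simps)
    ultimately show ?thesis by (simp add: power_divide)
  qed
  then have sl: "(1 - 2 * l) * (?b + ?s) \<le> l * ?a"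
    by (simp add: algebra_simps power2_eq_square power3_eq_cube power4_eq_xxxx)
  have "(1 - 2 * l) * (1 - l + l\<^sup>2) \<le> (1 - l) * 1"
    using l_pos l_less_half by (intro mult_mono) (auto simp: power2_eq_square)
  then have sl': "(1 - 2 * l) * (?a + ?s) \<le> ?b" by (simp add: as)
  \<comment> \<open>Both \<open>?a\<close> and \<open>?b\<close> decrease in \<open>l\<close>, so
    \<open>l0\<close> is the worst case; the product below is the value of \<open>?a\<close> at
    \<open>l0\<close> minus that at \<open>l\<close>.\<close>
  define l0 :: real where "l0 = 330384 / 1000000"
  have "0 \<le> (l - l0) * (1 - (l + l0) + (l\<^sup>2 + l * l0 + l0\<^sup>2))"
    using assms l_less_half l_pos by (intro mult_nonneg_nonneg add_nonneg_nonneg) (auto simp: l0_def)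
  then have "?a \<le> (1 - l0) * (1 + l0\<^sup>2)" by (simp add: power2_eq_square algebra_simps)
  then have "?a\<^sup>2 \<le> ((1 - l0) * (1 + l0\<^sup>2))\<^sup>2" using a by (intro power_mono) auto
  moreover have "?b\<^sup>2 \<le> (1 - l0)\<^sup>2" using assms l_less_half by (intro power_mono) (auto simp: l0_def)
  moreover have "((1 - l0) * (1 + l0\<^sup>2))\<^sup>2 + (1 - l0)\<^sup>2 \<le> 1"
    by (simp add: l0_def power2_eq_square)
  ultimately have low: "?a\<^sup>2 + ?b\<^sup>2 \<le> 1" by linarith
  \<comment> \<open>The sum of the two upper ends decreases in \<open>l\<close> up to
    \<open>l1\<close>, where it still exceeds \<open>283 / 200\<close>, a number above
    \<open>sqrt 2\<close>.\<close>
  define l1 :: real where "l1 = 163 / 400"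
  have "l\<^sup>2 \<le> (1 / 2)\<^sup>2" "l * l1 \<le> 1 / 2 * (1 / 2)"
    using l_pos l_less_half by (auto intro!: power_mono mult_mono simp: l1_def)
  then have "0 \<le> (l1 - l) * (2 - (l + l1) - (l\<^sup>2 + l * l1 + l1\<^sup>2))"
    using assms l_less_half by (intro mult_nonneg_nonneg) (auto simp: l1_def power2_eq_square)
  then have "2 - 2 * l1 + l1\<^sup>2 + l1 ^ 3 \<le> (?a + ?s) + (?b + ?s)"
    by (simp add: power2_eq_square power3_eq_cube algebra_simps)
  then have "283 / 200 \<le> (?a + ?s) + (?b + ?s)"
    by (simp add: l1_def power2_eq_square power3_eq_cube)
  then have "(283 / 200)\<^sup>2 \<le> ((?a + ?s) + (?b + ?s))\<^sup>2" by (intro power_mono) auto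
  also have "\<dots> \<le> 2 * ((?a + ?s)\<^sup>2 + (?b + ?s)\<^sup>2)" by (smt (verit) sum_squares_bound power2_sum)
  finally have high: "1 \<le> (?a + ?s)\<^sup>2 + (?b + ?s)\<^sup>2" by (simp add: power_divide)
  show "crossing_node ?a ?s ?b ?s"
    unfolding crossing_node_def
    using s a l_less_half copy_words low high mult_left_mono[OF sl, of ?s] mult_left_mono[OF sl', of ?s]
    by (auto simp: mult.left_commute)
qed

text \<open>The two intervals are the images of \<open>[0, 1]\<close> under \<open>f\<^sub>1 f\<^sub>1 f\<^sub>1 f\<^sub>0\<close> and \<open>f\<^sub>0 f\<^sub>1 f\<^sub>0\<close>; this choice
  works below the constant 0.407493 as well, which covers the range left open by
  \<open>section_nontrivial\<close>.\<close>
lemma section_continuum: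
  assumes "407 / 1000 \<le> l"
  shows "circle_section l \<approx> (UNIV :: real set)"
proof (rule section_eqpoll_real_of_node)
  let ?a = "1 - l ^ 3" and ?s = "l ^ 4" and ?b = "l * (1 - l)" and ?t = "l ^ 3"
  have pow: "l ^ 3 \<le> (1 / 2) ^ 3" "l\<^sup>2 \<le> (1 / 2)\<^sup>2" "l ^ 4 \<le> (1 / 2) ^ 4"
    using l_pos l_less_half by (auto intro!: power_mono)
  have pos: "0 < ?s" "0 < ?t" "0 < ?b" "0 < l\<^sup>2" "0 < ?a"
    using l_pos l_less_half pow(1) by (auto simp: power_divide)
  have "0 \<le> (l - 407 / 1000) * (1 - l - 407 / 1000)"
    using assms l_less_half by (intro mult_nonneg_nonneg) auto
  then have b_ge: "407 / 1000 * (593 / 1000) \<le> ?b" by (simp add: algebra_simps)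
  \<comment> \<open>Since \<open>?s = l * ?t\<close>, the first slope condition divided by
    \<open>?t\<close> and \<open>l\<close> reduces to this: the terms \<open>l ^ 4\<close>
    cancel.\<close>
  then have "(1 - l)\<^sup>2 < l" using assms by (simp add: power2_eq_square algebra_simps)
  then have "l * ((1 - l)\<^sup>2 - l ^ 4) < l * (l - l ^ 4)" using l_pos by simp
  then have "(1 - l - l\<^sup>2) * (?b + ?t) < l * (l * ?a)"
    by (simp add: power2_eq_square power3_eq_cube power4_eq_xxxx algebra_simps)
  then have "?t * ((1 - l - l\<^sup>2) * (?b + ?t)) < ?t * (l * (l * ?a))"
    using pos by simp
  then have sl: "(1 - l - l\<^sup>2) * (?t * (?b + ?t)) < l * (?s * ?a)"
    by (simp add: power3_eq_cube power4_eq_xxxx ac_simps)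
  have "(1 - 2 * l) * (?a + ?s) \<le> (1 - 2 * l) * 1"
    using l_pos l_less_half by (intro mult_left_mono) (auto intro: power_decreasing)
  then have "(1 - 2 * l) * (?a + ?s) < ?b" using assms b_ge by simp
  then have "?s * ((1 - 2 * l) * (?a + ?s)) < ?s * ?b" using pos by simp
  then have sl': "(1 - 2 * l) * (?s * (?a + ?s)) < l * (?t * ?b)"
    by (simp add: power3_eq_cube power4_eq_xxxx ac_simps)
  \<comment> \<open>The product equals \<open>?a\<^sup>2 + ?b\<^sup>2 - 1\<close>.\<close>
  have "l\<^sup>2 * (1 - 4 * l + l\<^sup>2 + l ^ 4) < 0"
    using pos pow assms by (intro mult_pos_neg) (auto simp: power_divide)
  then have low: "?a\<^sup>2 + ?b\<^sup>2 < 1"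
    by (simp add: power2_eq_square power3_eq_cube power4_eq_xxxx algebra_simps)
  \<comment> \<open>With \<open>?a + ?s = 1 - l\<^sup>2 * ?b\<close> and
    \<open>?b + ?t = l * (1 - ?b)\<close>, the upper corner lies outside the circle because
    \<open>?b\<close> is at most 1/4.\<close>
  have "0 \<le> (1 - 2 * l)\<^sup>2" by simp
  then have "0 \<le> 1 - 4 * ?b" by (simp add: power2_eq_square algebra_simps)
  then have "0 < l\<^sup>2 * ((1 - 4 * ?b) + ?b\<^sup>2 * (1 + l\<^sup>2))"
    using pos by (intro mult_pos_pos add_nonneg_pos) (auto intro: add_pos_pos)
  also have "\<dots> = (?a + ?s)\<^sup>2 + (?b + ?t)\<^sup>2 - 1" by algebra
  finally have high: "1 < (?a + ?s)\<^sup>2 + (?b + ?t)\<^sup>2" by simp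
  show "branching_node ?a ?s ?b ?t"
    unfolding branching_node_def using sl sl' low high copy_words pos by blast
qed

end

theorem theorem1p1:
  shows "(\<forall>l::real. 0 < l \<and> l \<le> 2 - sqrt 3 \<longrightarrow> trivial_section l) \<and>
    (\<forall>l::real. 330384 / 1000000 \<le> l \<and> l < 1 / 2 \<longrightarrow> \<not> trivial_section l) \<and>
    (\<forall>l::real. 407493 / 1000000 \<le> l \<and> l < 1 / 2 \<longrightarrow>
       circle_section l \<approx> (UNIV :: real set))"
proof (intro conjI allI impI)
  fix l :: real assume l: "0 < l \<and> l \<le> 2 - sqrt 3"
  have "3 / 2 < sqrt 3" by (rule real_less_rsqrt) (simp add: power2_eq_square)
  with l interpret middle_cantor l by unfold_locales auto
  show "trivial_section l" using section_trivial l by blast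
next
  fix l :: real assume l: "330384 / 1000000 \<le> l \<and> l < 1 / 2"
  then interpret middle_cantor l by unfold_locales auto
  show "\<not> trivial_section l"
  \<comment> \<open>Above \<open>163 / 400\<close> the section is infinite, while a trivial one has
    two points.\<close>
  proof (cases "l \<le> 163 / 400")
    case False
    then have "circle_section l \<approx> (UNIV :: real set)" using section_continuum by simp
    then have "infinite (circle_section l)"
      using eqpoll_finite_iff infinite_UNIV_char_0 by blast
    then show ?thesis by (auto simp: trivial_section_def)
  qed (use l section_nontrivial in blast)
next
  fix l :: real assume l: "407493 / 1000000 \<le> l \<and> l < 1 / 2"
  then interpret middle_cantor l by unfold_locales auto
  show "circle_section l \<approx> (UNIV :: real set)" using section_continuum l by simp
qed

end
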